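(* Consider the exponential family $f(x|\theta)=\beta(\theta)t(x)e^{-\theta r(x)}$ with natural parameter $\theta\in\Theta$, the intrinsic loss function $$L(\theta,\delta)=\log\frac{\beta(\theta)}{\beta(\delta)}+(\delta-\theta)\frac{\beta'(\theta)}{\beta(\theta)},$$ and a class $\Gamma^J$ of Jeffrey's Conjugate Prior (JCP) distributions for $\theta$. Suppose $\delta^{\Gamma^J}_{IPR}(X)$ is the posterior regret gamma-minimax (PRGM) estimator of $\theta$ under $L$ with respect to $\Gamma^J$. Then, for every one-to-one smooth transformation $h(\theta)$, the PRGM estimator of $h(\theta)$ (under the intrinsic loss and the corresponding class of JCP distributions for $h(\theta)$) is $h(\delta^{\Gamma^J}_{IPR}(X))$.
   Context: Setting. $\chi\subseteq\mathbb{R}$ is a sample space with a $\sigma$-finite measure $\nu$ (Lebesgue or counting measure), $\Theta\subseteq\mathbb{R}$ is an open interval, and $f(x|\theta)=\beta(\theta)t(x)e^{-\theta r(x)}$ is a one-parameter exponential family of densities with respect to $\nu$, with $r(x)>0$, $\beta(\theta)>0$, $t(x)>0$, $r$ not $\nu$-a.e. constant. Put $H=\beta'/\beta$; then $E_\theta[r(X)]=H(\theta)$, $H$ is strictly decreasing, and the Fisher information for $\theta$ is $I_\theta(\theta)=-H'(\theta)$. The loss $L(\theta,\delta)$ equals the Kullback–Leibler divergence $E_\theta[\log(f(X|\theta)/f(X|\delta))]$. JCP. For real hyper-parameters $\alpha,\lambda$ the Jeffrey's Conjugate Prior for $\theta$ is $\pi^J_{\alpha,\lambda}(\theta)\propto\{\beta(\theta)\}^\alpha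 e^{-\lambda\theta}\sqrt{I_\theta(\theta)}$. A class $\Gamma^J$ of JCP distributions is a set of such priors, indexed by a set of pairs $(\alpha,\lambda)$ for which the posteriors are proper and the posterior expectations $E_\pi[L(\theta,\delta)|x]$, $\delta\in\Theta$, are finite. Bayes and PRGM estimation. For a prior $\pi$ the posterior is $\pi(\theta|x)\propto f(x|\theta)\pi(\theta)$; the posterior risk of $\delta$ is $r_\pi(x,\delta)=E_\pi[L(\theta,\delta)|x]$, assumed finite; the Bayes estimate $\delta_\pi(x)$ minimizes it over $\delta\in\Theta$; the posterior regret is $\rho(\delta_\pi(x),\delta)=r_\pi(x,\delta)-r_\pi(x,\delta_\pi(x))$. A PRGM estimator over a class $\Gamma$ is a $\Theta$-valued $\delta_{PR}$ with $\sup_{\pi\in\Gamma}\rho(\delta_\pi(x),\delta_{PR}(x))=\inf_{\delta\in\Theta}\sup_{\pi\in\Gamma}\rho(\delta_\pi(x),\delta)$. Reparameterization. A one-to-one smooth transformation $h$ is a diffeomorphism of $\Theta$ onto $h(\Theta)$. With $\eta=h(\theta)$ the model is $\{f(\cdot|h^{-1}(\eta)):\eta\in h(\Theta)\}$, the intrinsic loss for estimating $\eta$ by $d\in h(\Theta)$ is the Kullback–Leibler divergence between the labelled models, i.e. $L(h^{-1}(\eta),h^{-1}(d))$, and the JCP for $\eta$ with hyper-parameters $(\alpha,\lambda)$ is $\propto\{\beta(h^{-1}(\eta))\}^\alpha e^{-\lambda h^{-1}(\eta)}\sqrt{I_\eta(\eta)}$ with $I_\eta(\eta)=I_\theta(h^{-1}(\eta))\,|\tfrac{d}{d\eta}h^{-1}(\eta)|^2$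 the Fisher information for $\eta$. The corresponding class for $\eta$, denoted $\tilde\Gamma^J$, uses the same set of pairs $(\alpha,\lambda)$. For a prior $\tilde\pi\in\tilde\Gamma^J$ on $\eta$, the posterior is $\tilde\pi(\eta|x)\propto f(x|h^{-1}(\eta))\tilde\pi(\eta)$; the posterior risk of $d\in h(\Theta)$ is $\tilde r_{\tilde\pi}(x,d)=E_{\tilde\pi}[L(h^{-1}(\eta),h^{-1}(d))|x]$; the Bayes estimate $\tilde\delta_{\tilde\pi}(x)$ of $\eta$ minimizes $\tilde r_{\tilde\pi}(x,d)$ over $d\in h(\Theta)$; the posterior regret is $\tilde\rho(\tilde\delta_{\tilde\pi}(x),d)=\tilde r_{\tilde\pi}(x,d)-\tilde r_{\tilde\pi}(x,\tilde\delta_{\tilde\pi}(x))$; and a PRGM estimator of $\eta$ is an $h(\Theta)$-valued $\tilde\delta_{PR}$ with $\sup_{\tilde\pi\in\tilde\Gamma^J}\tilde\rho(\tilde\delta_{\tilde\pi}(x),\tilde\delta_{PR}(x))=\inf_{d\in h(\Theta)}\sup_{\tilde\pi\in\tilde\Gamma^J}\tilde\rho(\tilde\delta_{\tilde\pi}(x),d)$. *)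

theory Defs
  imports "HOL-Probability.Probability"
begin

section \<open>One-parameter exponential families\<close>

text \<open>
  Densities are written parameter first: \<open>f u x\<close> is the density at \<open>x\<close> under the parameter
  value \<open>u\<close>, with respect to a reference measure \<open>\<nu>\<close> whose space is the sample space.
\<close>

definition ef_density :: "(real \<Rightarrow> real) \<Rightarrow> (real \<Rightarrow> real) \<Rightarrow> (real \<Rightarrow> real) \<Rightarrow> real \<Rightarrow> real \<Rightarrow> real" where
  "ef_density \<beta> t r \<theta> x = \<beta> \<theta> * t x * exp (- \<theta> * r x)"

definition model :: "real measure \<Rightarrow> (real \<Rightarrow> real \<Rightarrow> real) \<Rightarrow> real \<Rightarrow> real measure" where
  "model \<nu> f u = density \<nu> (\<lambda>x. ennreal (f u x))"

text \<open>
  Differentiability of \<open>\<beta>\<close> is not assumed: it follows from the normalisation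
  \<open>1 / \<beta> \<theta> = (\<integral>x. t x * exp (- \<theta> * r x) \<partial>\<nu>)\<close> on the open set \<open>\<Theta>\<close>.
\<close>

locale exp_family = sigma_finite_measure \<nu>
  for \<nu> :: "real measure" +
  fixes \<Theta> :: "real set" and \<beta> t r :: "real \<Rightarrow> real"
  assumes open_Theta: "open \<Theta>"
    and interval_Theta: "is_interval \<Theta>"
    and nonempty_Theta: "\<Theta> \<noteq> {}"
    and measurable_t: "t \<in> borel_measurable \<nu>"
    and measurable_r: "r \<in> borel_measurable \<nu>"
    and t_pos: "\<And>x. x \<in> space \<nu> \<Longrightarrow> t x > 0"
    and r_pos: "\<And>x. x \<in> space \<nu> \<Longrightarrow> r x > 0"
    and beta_pos: "\<And>\<theta>. \<theta> \<in> \<Theta> \<Longrightarrow> \<beta> \<theta> > 0"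
    and prob_space_model: "\<And>\<theta>. \<theta> \<in> \<Theta> \<Longrightarrow> prob_space (model \<nu> (ef_density \<beta> t r) \<theta>)"
    and r_not_AE_const: "\<not> (\<exists>c. AE x in \<nu>. r x = c)"

definition fisher_info :: "real measure \<Rightarrow> (real \<Rightarrow> real \<Rightarrow> real) \<Rightarrow> real \<Rightarrow> real" where
  "fisher_info \<nu> f u = (\<integral>x. (deriv (\<lambda>v. ln (f v x)) u)\<^sup>2 \<partial>model \<nu> f u)"

section \<open>Intrinsic loss\<close>

text \<open>
  The second measure argument of \<^const>\<open>KL_divergence\<close> is the one the expectation is taken in,
  so \<open>kl_loss \<nu> f u d\<close> is the expectation under \<open>f u\<close> of the logarithm of \<open>f u X / f d X\<close>.
\<close>

definition kl_loss :: "real measure \<Rightarrow> (real \<Rightarrow> real \<Rightarrow> real) \<Rightarrow> real \<Rightarrow> real \<Rightarrow> real" where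
  "kl_loss \<nu> f u d = KL_divergence (exp 1) (model \<nu> f d) (model \<nu> f u)"

definition intrinsic_loss :: "(real \<Rightarrow> real) \<Rightarrow> real \<Rightarrow> real \<Rightarrow> real" where
  "intrinsic_loss \<beta> \<theta> \<delta> = ln (\<beta> \<theta> / \<beta> \<delta>) + (\<delta> - \<theta>) * (deriv \<beta> \<theta> / \<beta> \<theta>)"

section \<open>Jeffrey's conjugate priors\<close>

text \<open>
  Priors are represented by unnormalised, possibly improper densities; multiplying one by a
  positive constant does not change the posterior. The argument \<open>\<psi>\<close> sends a label of the model to its
  natural parameter: it is the identity for the natural parameter itself, and the inverse of \<open>h\<close>
  for \<open>\<eta> = h \<theta>\<close>. The Fisher information is that of the labelled model, so it includes
  the squared derivative of \<open>\<psi>\<close>.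
\<close>

definition jcp ::
  "real measure \<Rightarrow> (real \<Rightarrow> real) \<Rightarrow> (real \<Rightarrow> real) \<Rightarrow> (real \<Rightarrow> real) \<Rightarrow> (real \<Rightarrow> real) \<Rightarrow> real \<times> real \<Rightarrow> real \<Rightarrow> real" where
  "jcp \<nu> \<beta> t r \<psi> = (\<lambda>(\<alpha>, l) u. \<beta> (\<psi> u) powr \<alpha> * exp (- l * \<psi> u)
     * sqrt (fisher_info \<nu> (\<lambda>v. ef_density \<beta> t r (\<psi> v)) u))"

definition jcp_priors ::
  "real measure \<Rightarrow> (real \<Rightarrow> real) \<Rightarrow> (real \<Rightarrow> real) \<Rightarrow> (real \<Rightarrow> real) \<Rightarrow> (real \<Rightarrow> real) \<Rightarrow> (real \<times> real) set
     \<Rightarrow> (real \<Rightarrow> real) set" where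
  "jcp_priors \<nu> \<beta> t r \<psi> P = jcp \<nu> \<beta> t r \<psi> ` P"

section \<open>Bayes and posterior regret gamma-minimax estimation\<close>

text \<open>
  Below, \<open>X\<close> is the sample space, \<open>U\<close> the parameter set, \<open>f\<close> the family of densities, \<open>\<pi>\<close> an unnormalised prior density
  on \<open>U\<close> with respect to Lebesgue measure, and \<open>L\<close> the loss.
\<close>

definition posterior_density ::
  "real set \<Rightarrow> (real \<Rightarrow> real \<Rightarrow> real) \<Rightarrow> (real \<Rightarrow> real) \<Rightarrow> real \<Rightarrow> real \<Rightarrow> real" where
  "posterior_density U f \<pi> x u = f u x * \<pi> u / (LINT v:U|lebesgue. f v x * \<pi> v)"

definition posterior_proper ::
  "real set \<Rightarrow> (real \<Rightarrow> real \<Rightarrow> real) \<Rightarrow> (real \<Rightarrow> real) \<Rightarrow> real \<Rightarrow> bool" where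
  "posterior_proper U f \<pi> x \<longleftrightarrow>
     set_integrable lebesgue U (\<lambda>u. f u x * \<pi> u) \<and> 0 < (LINT u:U|lebesgue. f u x * \<pi> u)"

definition posterior_risk ::
  "real set \<Rightarrow> (real \<Rightarrow> real \<Rightarrow> real) \<Rightarrow> (real \<Rightarrow> real \<Rightarrow> real) \<Rightarrow> (real \<Rightarrow> real) \<Rightarrow> real \<Rightarrow> real \<Rightarrow> real" where
  "posterior_risk U f L \<pi> x d = (LINT u:U|lebesgue. L u d * posterior_density U f \<pi> x u)"

definition posterior_risk_finite ::
  "real set \<Rightarrow> (real \<Rightarrow> real \<Rightarrow> real) \<Rightarrow> (real \<Rightarrow> real \<Rightarrow> real) \<Rightarrow> (real \<Rightarrow> real) \<Rightarrow> real \<Rightarrow> real \<Rightarrow> bool" where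
  "posterior_risk_finite U f L \<pi> x d \<longleftrightarrow>
     set_integrable lebesgue U (\<lambda>u. L u d * posterior_density U f \<pi> x u)"

definition admissible_class ::
  "real set \<Rightarrow> real set \<Rightarrow> (real \<Rightarrow> real \<Rightarrow> real) \<Rightarrow> (real \<Rightarrow> real \<Rightarrow> real) \<Rightarrow> (real \<Rightarrow> real) set \<Rightarrow> bool" where
  "admissible_class X U f L \<Gamma> \<longleftrightarrow>
     (\<forall>\<pi>\<in>\<Gamma>. \<forall>x\<in>X. posterior_proper U f \<pi> x \<and> (\<forall>d\<in>U. posterior_risk_finite U f L \<pi> x d))"

definition bayes_estimate ::
  "real set \<Rightarrow> (real \<Rightarrow> real \<Rightarrow> real) \<Rightarrow> (real \<Rightarrow> real \<Rightarrow> real) \<Rightarrow> (real \<Rightarrow> real) \<Rightarrow> real \<Rightarrow> real" where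
  "bayes_estimate U f L \<pi> x = arg_min_on (posterior_risk U f L \<pi> x) U"

definition posterior_regret ::
  "real set \<Rightarrow> (real \<Rightarrow> real \<Rightarrow> real) \<Rightarrow> (real \<Rightarrow> real \<Rightarrow> real) \<Rightarrow> (real \<Rightarrow> real) \<Rightarrow> real \<Rightarrow> real \<Rightarrow> real" where
  "posterior_regret U f L \<pi> x d =
     posterior_risk U f L \<pi> x d - posterior_risk U f L \<pi> x (bayes_estimate U f L \<pi> x)"

text \<open>
  Suprema of regrets over the class are taken in the extended reals, as they may be infinite.
\<close>

definition prgm_estimator ::
  "real set \<Rightarrow> real set \<Rightarrow> (real \<Rightarrow> real \<Rightarrow> real) \<Rightarrow> (real \<Rightarrow> real \<Rightarrow> real) \<Rightarrow> (real \<Rightarrow> real) set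
     \<Rightarrow> (real \<Rightarrow> real) \<Rightarrow> bool" where
  "prgm_estimator X U f L \<Gamma> \<delta> \<longleftrightarrow>
     (\<forall>x\<in>X. \<delta> x \<in> U \<and>
        (SUP \<pi>\<in>\<Gamma>. ereal (posterior_regret U f L \<pi> x (\<delta> x)))
          = (INF d\<in>U. SUP \<pi>\<in>\<Gamma>. ereal (posterior_regret U f L \<pi> x d)))"

section \<open>Smooth reparameterizations\<close>

text \<open>
  Only continuous differentiability in both directions is required, so diffeomorphisms of every
  smoothness class are covered. For open \<open>S\<close> the image \<open>h ` S\<close> is open as well, so the derivatives
  of the inverse depend only on its values on \<open>h ` S\<close>.
\<close>

definition C1_diffeo_on :: "(real \<Rightarrow> real) \<Rightarrow> real set \<Rightarrow> bool" where
  "C1_diffeo_on h S \<longleftrightarrow>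
     inj_on h S \<and> h C1_differentiable_on S \<and> the_inv_into S h C1_differentiable_on (h ` S)"

end

theory Submission
  imports Defs
begin

text \<open>
  Substituting \<open>\<eta> = h \<theta>\<close> turns the Jeffreys conjugate prior for \<open>\<eta>\<close> into that for \<open>\<theta>\<close>, the square root
  of the Fisher information supplying the Jacobian, and the Kullback-Leibler loss does not depend on
  the labels. So posterior risks agree under relabelling. Posterior regrets agree as well, provided the
  infimum of the posterior risk is attained. This holds because \<open>H = \<beta>' / \<beta>\<close> is the mean of \<open>r\<close>,
  is continuous, and hence takes its own posterior mean as a value.
\<close>

section \<open>Differentiating Laplace integrals\<close>

text \<open>Second-order Taylor remainder of \<open>exp\<close> with constant 1 in place of 1/2. The
  tangent inequality \<open>1 + u \<le> exp u\<close>, applied at \<open>u\<close> and at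
  \<open>- u\<close>, then suffices.\<close>

lemma exp_minus_linear_bound:
  fixes u :: real
  shows "\<bar>exp u - 1 - u\<bar> \<le> u\<^sup>2 * exp \<bar>u\<bar>"
proof -
  have lo: "1 + u \<le> exp u" by simp
  have "1 - u \<le> exp (- u)" using exp_ge_add_one_self[of "- u"] by simp
  then have "(1 - u) * exp u \<le> exp (- u) * exp u" by (intro mult_right_mono) auto
  then have hi: "exp u - 1 \<le> u * exp u" by (simp add: algebra_simps flip: exp_add)
  have "exp u - 1 - u \<le> u * (exp u - 1)" using hi by (simp add: algebra_simps)
  also have "u * (exp u - 1) \<le> u\<^sup>2 * exp \<bar>u\<bar>"
  proof (cases "u \<ge> 0")
    case True
    then have "u * (exp u - 1) \<le> u * (u * exp u)" using hi by (intro mult_left_mono) auto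
    then show ?thesis using True by (simp add: power2_eq_square)
  next
    case False
    then have "(- u) * (1 - exp u) \<le> (- u) * (- u)" using lo by (intro mult_left_mono; linarith)
    also have "\<dots> \<le> u\<^sup>2 * exp \<bar>u\<bar>"
      using mult_left_mono[of 1 "exp \<bar>u\<bar>" "u\<^sup>2"] by (simp add: power2_eq_square)
    finally show ?thesis by (simp add: algebra_simps)
  qed
  finally show ?thesis using lo by linarith
qed

text \<open>Differentiation under the integral with an explicit error of order
  \<open>h\<^sup>2\<close>. Since \<open>r\<close> is non-negative, a growth factor
  \<open>exp (c * r x)\<close> is absorbed by lowering the parameter by \<open>c\<close>, and
  openness of \<open>S\<close> leaves room for this. The free weight \<open>w\<close> allows a
  second application, to first moments.\<close>

lemma laplace_integral_derivative:
  fixes w r :: "'a \<Rightarrow> real"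
  assumes [measurable]: "w \<in> borel_measurable M" "r \<in> borel_measurable M"
    and w: "\<And>x. x \<in> space M \<Longrightarrow> w x \<ge> 0" and r: "\<And>x. x \<in> space M \<Longrightarrow> r x \<ge> 0"
    and S: "open S" and \<theta>: "\<theta> \<in> S"
    and int: "\<And>s. s \<in> S \<Longrightarrow> integrable M (\<lambda>x. w x * exp (- s * r x))"
  shows "integrable M (\<lambda>x. r x * w x * exp (- \<theta> * r x))" (is "integrable M ?D")
    and "((\<lambda>s. \<integral>x. w x * exp (- s * r x) \<partial>M) has_real_derivative
           - (\<integral>x. r x * w x * exp (- \<theta> * r x) \<partial>M)) (at \<theta>)"
proof -
  obtain e where e: "e > 0" "ball \<theta> e \<subseteq> S" using S \<theta> open_contains_ball by blast
  \<comment> \<open>The estimates lower the parameter by up to \<open>3 * c\<close>; a quarter of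
    the radius keeps that strictly inside the ball.\<close>
  define c where "c = e / 4"
  have c: "c > 0" using e by (simp add: c_def)
  have near: "\<theta> + h \<in> S" if "\<bar>h\<bar> \<le> 3 * c" for h
    using e that by (intro subsetD[OF e(2)]) (auto simp: dist_real_def c_def)
  \<comment> \<open>Trades each factor \<open>c * r x\<close> for an exponential, hence for a
    parameter shift by \<open>- c\<close>.\<close>
  have lin: "c * r x \<le> exp (c * r x)" for x
    using exp_ge_add_one_self[of "c * r x"] by linarith
  let ?F = "\<lambda>s x. w x * exp (- s * r x)"
  \<comment> \<open>Dominating function for the remainder. Of the shift \<open>3 * c\<close>, one
    \<open>c\<close> pays for \<open>exp \<bar>u\<bar>\<close> in the Taylor bound and two pay for
    the square of \<open>r x\<close>; the division by \<open>c\<^sup>2\<close> undoes the scaling of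
    that square.\<close>
  let ?G = "\<lambda>x. ?F (\<theta> - 3 * c) x / c\<^sup>2"
  have intG: "integrable M ?G" using near[of "- (3 * c)"] c by (intro integrable_divide int) auto
  show intD: "integrable M ?D"
  proof (rule Bochner_Integration.integrable_bound)
    show "integrable M (\<lambda>x. ?F (\<theta> - c) x / c)"
      using near[of "- c"] c by (intro integrable_divide int) auto
    show "AE x in M. norm (?D x) \<le> norm (?F (\<theta> - c) x / c)"
    proof (rule AE_I2)
      fix x assume x: "x \<in> space M"
      have "c * r x * (w x * exp (- \<theta> * r x)) \<le> exp (c * r x) * (w x * exp (- \<theta> * r x))"
        using lin w[OF x] by (intro mult_right_mono) auto
      also have "\<dots> = ?F (\<theta> - c) x" by (simp add: algebra_simps flip: exp_add)
      finally show "norm (?D x) \<le> norm (?F (\<theta> - c) x / c)"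
        using c w[OF x] r[OF x] by (simp add: field_simps)
    qed
  qed measurable
  let ?I = "\<lambda>s. \<integral>x. ?F s x \<partial>M"
  have bound: "\<bar>?I (\<theta> + h) - ?I \<theta> + h * (\<integral>x. ?D x \<partial>M)\<bar> \<le> h\<^sup>2 * (\<integral>x. ?G x \<partial>M)"
    if h: "\<bar>h\<bar> \<le> c" for h
  proof -
    have ih: "integrable M (?F (\<theta> + h))" using near[of h] h c by (intro int) auto
    have i0: "integrable M (?F \<theta>)" using \<theta> by (intro int)
    let ?E = "\<lambda>x. ?F (\<theta> + h) x - ?F \<theta> x + h * ?D x"
    have iE: "integrable M ?E" using ih i0 intD by auto
    have eq: "?I (\<theta> + h) - ?I \<theta> + h * (\<integral>x. ?D x \<partial>M) = (\<integral>x. ?E x \<partial>M)"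
      using ih i0 intD by simp
    have "\<bar>\<integral>x. ?E x \<partial>M\<bar> \<le> (\<integral>x. \<bar>?E x\<bar> \<partial>M)" by (rule integral_abs_bound)
    also have "\<dots> \<le> (\<integral>x. h\<^sup>2 * ?G x \<partial>M)"
    proof (rule integral_mono)
      show "integrable M (\<lambda>x. \<bar>?E x\<bar>)" using iE by (rule integrable_abs)
      show "integrable M (\<lambda>x. h\<^sup>2 * ?G x)" using intG by (rule integrable_mult_right)
      fix x assume x: "x \<in> space M"
      let ?u = "- (h * r x)"
      have "- (\<theta> + h) * r x = - \<theta> * r x + ?u" by (simp add: algebra_simps)
      then have "exp (- (\<theta> + h) * r x) = exp (- \<theta> * r x) * exp ?u"
        by (simp only: exp_add)
      \<comment> \<open>The term \<open>h * ?D x\<close> equals \<open>- ?F \<theta> x * ?u\<close>,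
        so exactly the second-order remainder of \<open>exp\<close> at \<open>?u\<close> is
        left.\<close>
      then have "?E x = ?F \<theta> x * (exp ?u - 1 - ?u)"
        by (simp only: right_diff_distrib) (simp add: mult_ac)
      then have "\<bar>?E x\<bar> = ?F \<theta> x * \<bar>exp ?u - 1 - ?u\<bar>"
        using w[OF x] by (simp only: abs_mult) simp
      also have "\<dots> \<le> ?F \<theta> x * (?u\<^sup>2 * exp \<bar>?u\<bar>)"
        using w[OF x] by (intro mult_left_mono exp_minus_linear_bound) auto
      also have "\<dots> \<le> ?F \<theta> x * (?u\<^sup>2 * exp (c * r x))"
        using w[OF x] h r[OF x] by (intro mult_left_mono) (auto simp: abs_mult intro: mult_right_mono)
      also have "\<dots> = h\<^sup>2 * (?F \<theta> x * exp (c * r x)) * ((c * r x)\<^sup>2 / c\<^sup>2)"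
        using c by (simp add: power_mult_distrib)
      also have "\<dots> \<le> h\<^sup>2 * (?F \<theta> x * exp (c * r x)) * ((exp (c * r x))\<^sup>2 / c\<^sup>2)"
        using w[OF x] r[OF x] c lin[of x]
        by (intro mult_left_mono divide_right_mono power_mono) auto
      also have "\<dots> = h\<^sup>2 * ?G x"
      proof -
        have "exp (- \<theta> * r x) * exp (c * r x) * (exp (c * r x))\<^sup>2
            = exp (- \<theta> * r x + c * r x + (c * r x + c * r x))"
          by (simp only: exp_add power2_eq_square)
        also have "- \<theta> * r x + c * r x + (c * r x + c * r x) = - (\<theta> - 3 * c) * r x"
          by (simp add: algebra_simps)
        finally show ?thesis by (simp add: mult_ac)
      qed
      finally show "\<bar>?E x\<bar> \<le> h\<^sup>2 * ?G x" .
    qed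
    finally show ?thesis unfolding eq by simp
  qed
  let ?K = "\<integral>x. ?G x \<partial>M"
  let ?Q = "\<lambda>h. (?I (\<theta> + h) - ?I \<theta>) / h - - (\<integral>x. ?D x \<partial>M)"
  have ev: "\<forall>\<^sub>F h in at 0. norm (?Q h) \<le> \<bar>h\<bar> * ?K"
  proof -
    have "norm (?Q h) \<le> \<bar>h\<bar> * ?K" if "h \<noteq> 0" "\<bar>h\<bar> \<le> c" for h
    proof -
      have sq: "h\<^sup>2 * k / \<bar>h\<bar> = \<bar>h\<bar> * k" for k
        using that(1) by (cases "h > 0") (simp_all add: power2_eq_square)
      have "?Q h = (?I (\<theta> + h) - ?I \<theta> + h * (\<integral>x. ?D x \<partial>M)) / h"
        using that by (simp add: field_simps)
      then have "norm (?Q h) = \<bar>?I (\<theta> + h) - ?I \<theta> + h * (\<integral>x. ?D x \<partial>M)\<bar> / \<bar>h\<bar>" by simp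
      also have "\<dots> \<le> h\<^sup>2 * ?K / \<bar>h\<bar>" using bound[OF that(2)] by (intro divide_right_mono) auto
      also have "\<dots> = \<bar>h\<bar> * ?K" by (rule sq)
      finally show ?thesis .
    qed
    then show ?thesis unfolding eventually_at
      by (intro exI[of _ c]) (use c in \<open>auto simp: dist_real_def\<close>)
  qed
  have "((\<lambda>h. \<bar>h\<bar> * ?K) \<longlongrightarrow> \<bar>0\<bar> * ?K) (at 0)" by (intro tendsto_intros)
  then have "(?Q \<longlongrightarrow> 0) (at 0)" by (intro Lim_null_comparison[OF ev]) simp
  then have "((\<lambda>h. (?I (\<theta> + h) - ?I \<theta>) / h) \<longlongrightarrow> - (\<integral>x. ?D x \<partial>M)) (at 0)"
    by (rule LIM_zero_cancel)
  then show "(?I has_real_derivative - (\<integral>x. ?D x \<partial>M)) (at \<theta>)"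
    unfolding DERIV_def .
qed

section \<open>The mean of the sufficient statistic and the intrinsic loss\<close>

context exp_family
begin

abbreviation f :: "real \<Rightarrow> real \<Rightarrow> real" where "f \<equiv> ef_density \<beta> t r"
abbreviation H :: "real \<Rightarrow> real" where "H \<theta> \<equiv> deriv \<beta> \<theta> / \<beta> \<theta>"

lemma measurable_f [measurable]: "f \<theta> \<in> borel_measurable \<nu>"
  using measurable_t measurable_r unfolding ef_density_def by measurable

lemma f_pos: "\<theta> \<in> \<Theta> \<Longrightarrow> x \<in> space \<nu> \<Longrightarrow> f \<theta> x > 0"
  using beta_pos t_pos by (simp add: ef_density_def)

lemma has_bochner_integral_f:
  assumes \<theta>: "\<theta> \<in> \<Theta>"
  shows "has_bochner_integral \<nu> (f \<theta>) 1"
proof -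
  interpret m: prob_space "model \<nu> f \<theta>" by (rule prob_space_model[OF \<theta>])
  have "emeasure (model \<nu> f \<theta>) (space \<nu>) = 1"
    using m.emeasure_space_1 by (simp add: model_def)
  then have "(\<integral>\<^sup>+x. ennreal (f \<theta> x) \<partial>\<nu>) = ennreal 1"
    by (simp add: model_def emeasure_density cong: nn_integral_cong)
  then show ?thesis
    using f_pos[OF \<theta>] by (intro has_bochner_integral_nn_integral) (auto intro!: AE_I2 less_imp_le)
qed

lemma integrable_kernel:
  assumes \<theta>: "\<theta> \<in> \<Theta>"
  shows "integrable \<nu> (\<lambda>x. t x * exp (- \<theta> * r x))"
    and "\<beta> \<theta> * (\<integral>x. t x * exp (- \<theta> * r x) \<partial>\<nu>) = 1"
proof -
  have f: "f \<theta> = (\<lambda>x. \<beta> \<theta> * (t x * exp (- \<theta> * r x)))" by (auto simp: ef_density_def)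
  have "integrable \<nu> (f \<theta>)" "integral\<^sup>L \<nu> (f \<theta>) = 1"
    using has_bochner_integral_f[OF \<theta>] by (auto simp: has_bochner_integral_iff)
  then show "integrable \<nu> (\<lambda>x. t x * exp (- \<theta> * r x))"
    and "\<beta> \<theta> * (\<integral>x. t x * exp (- \<theta> * r x) \<partial>\<nu>) = 1"
    using beta_pos[OF \<theta>] unfolding f by auto
qed

lemma integrable_r_kernel:
  "\<theta> \<in> \<Theta> \<Longrightarrow> integrable \<nu> (\<lambda>x. r x * t x * exp (- \<theta> * r x))"
  using measurable_t measurable_r t_pos r_pos open_Theta integrable_kernel(1)
  by (intro laplace_integral_derivative(1)[where S=\<Theta>]) (auto intro: less_imp_le)

text \<open>By normalisation \<beta> is the reciprocal of the Laplace integral \<open>?Z\<close> on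
  \<Theta>, so its derivative is \<open>- ?Z' / ?Z\<^sup>2\<close>. Agreement on the open set
  \<Theta> is enough to transfer the derivative to \<beta>.\<close>

lemma beta_has_derivative:
  assumes \<theta>: "\<theta> \<in> \<Theta>"
  shows "(\<beta> has_real_derivative (\<beta> \<theta>)\<^sup>2 * (\<integral>x. r x * t x * exp (- \<theta> * r x) \<partial>\<nu>)) (at \<theta>)"
proof -
  let ?Z = "\<lambda>s. \<integral>x. t x * exp (- s * r x) \<partial>\<nu>"
  let ?M = "\<integral>x. r x * t x * exp (- \<theta> * r x) \<partial>\<nu>"
  have Z: "\<beta> s = inverse (?Z s)" "?Z s \<noteq> 0" if "s \<in> \<Theta>" for s
    using integrable_kernel(2)[OF that] by (auto simp: inverse_unique mult.commute)
  have "(?Z has_real_derivative - ?M) (at \<theta>)"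
    using measurable_t measurable_r t_pos r_pos open_Theta integrable_kernel(1) \<theta>
    by (intro laplace_integral_derivative(2)[where S=\<Theta>]) (auto intro: less_imp_le)
  then have "((\<lambda>s. inverse (?Z s)) has_real_derivative
      - (inverse (?Z \<theta>) * - ?M * inverse (?Z \<theta>))) (at \<theta>)"
    using Z(2)[OF \<theta>] by (rule DERIV_inverse')
  then have "((\<lambda>s. inverse (?Z s)) has_real_derivative (\<beta> \<theta>)\<^sup>2 * ?M) (at \<theta>)"
    using Z(1)[OF \<theta>] by (simp add: power2_eq_square mult_ac)
  then show ?thesis
    by (rule has_field_derivative_transform_within_open[OF _ open_Theta \<theta>]) (simp add: Z(1))
qed

lemma H_eq: "\<theta> \<in> \<Theta> \<Longrightarrow> H \<theta> = \<beta> \<theta> * (\<integral>x. r x * t x * exp (- \<theta> * r x) \<partial>\<nu>)"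
  using beta_pos[of \<theta>] DERIV_imp_deriv[OF beta_has_derivative, of \<theta>] by (simp add: power2_eq_square)

lemma H_eq_mean:
  assumes \<theta>: "\<theta> \<in> \<Theta>"
  shows "has_bochner_integral \<nu> (\<lambda>x. f \<theta> x * r x) (H \<theta>)"
proof -
  have "has_bochner_integral \<nu> (\<lambda>x. \<beta> \<theta> * (r x * t x * exp (- \<theta> * r x))) (H \<theta>)"
    using integrable_r_kernel[OF \<theta>] by (simp only: H_eq[OF \<theta>] has_bochner_integral_iff) simp
  then show ?thesis by (simp add: ef_density_def mult_ac)
qed

text \<open>Both factors in \<open>H_eq\<close> are differentiable: \<beta> by
  \<open>beta_has_derivative\<close>, the first moment by \<open>laplace_integral_derivative\<close>
  with weight \<open>r x * t x\<close>.\<close>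

lemma continuous_on_H: "continuous_on \<Theta> H"
proof -
  have "isCont (\<lambda>s. \<beta> s * (\<integral>x. r x * t x * exp (- s * r x) \<partial>\<nu>)) \<theta>" if \<theta>: "\<theta> \<in> \<Theta>" for \<theta>
  proof (rule isCont_mult)
    show "isCont \<beta> \<theta>" using beta_has_derivative[OF \<theta>] by (rule DERIV_isCont)
    show "isCont (\<lambda>s. \<integral>x. r x * t x * exp (- s * r x) \<partial>\<nu>) \<theta>"
      using measurable_t measurable_r t_pos r_pos open_Theta integrable_r_kernel \<theta>
      by (intro DERIV_isCont[OF laplace_integral_derivative(2)[where S=\<Theta>]])
        (auto intro: less_imp_le)
  qed
  then have "continuous_on \<Theta> (\<lambda>s. \<beta> s * (\<integral>x. r x * t x * exp (- s * r x) \<partial>\<nu>))"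
    by (simp add: continuous_at_imp_continuous_on)
  then show ?thesis by (simp add: H_eq cong: continuous_on_cong)
qed

text \<open>The log-likelihood ratio is affine in \<open>r x\<close>, so its mean under \<theta> is
  determined by the total mass 1 and the mean \<open>H \<theta>\<close> of \<open>r\<close>.
  Non-negativity is Gibbs' inequality for the two models.\<close>

lemma kl_loss_eq_intrinsic:
  assumes \<theta>: "\<theta> \<in> \<Theta>" and \<delta>: "\<delta> \<in> \<Theta>"
  shows "kl_loss \<nu> f \<theta> \<delta> = intrinsic_loss \<beta> \<theta> \<delta>"
    and "intrinsic_loss \<beta> \<theta> \<delta> \<ge> 0"
proof -
  let ?g = "\<lambda>x. ln (\<beta> \<theta> / \<beta> \<delta>) * f \<theta> x + (\<delta> - \<theta>) * (f \<theta> x * r x)"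
  have eq: "f \<theta> x * log (exp 1) (f \<theta> x / f \<delta> x) = ?g x" if x: "x \<in> space \<nu>" for x
  proof -
    have eq: "f \<theta> x / f \<delta> x = \<beta> \<theta> / \<beta> \<delta> * exp ((\<delta> - \<theta>) * r x)"
      using t_pos[OF x] by (simp add: ef_density_def left_diff_distrib exp_diff exp_minus field_simps)
    have "ln (f \<theta> x / f \<delta> x) = ln (\<beta> \<theta> / \<beta> \<delta>) + (\<delta> - \<theta>) * r x"
      unfolding eq using beta_pos[OF \<theta>] beta_pos[OF \<delta>] by (subst ln_mult_pos) auto
    then show ?thesis by (simp add: log_def distrib_left mult_ac)
  qed
  have "has_bochner_integral \<nu> ?g (ln (\<beta> \<theta> / \<beta> \<delta>) * 1 + (\<delta> - \<theta>) * H \<theta>)"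
    by (intro has_bochner_integral_add has_bochner_integral_mult_right has_bochner_integral_f[OF \<theta>] H_eq_mean[OF \<theta>])
  then have g: "has_bochner_integral \<nu> (\<lambda>x. f \<theta> x * log (exp 1) (f \<theta> x / f \<delta> x)) (intrinsic_loss \<beta> \<theta> \<delta>)"
    by (simp add: eq intrinsic_loss_def cong: has_bochner_integral_cong)
  have pos: "AE x in \<nu>. 0 \<le> f s x" if "s \<in> \<Theta>" for s
    using f_pos[OF that] by (auto intro!: AE_I2 less_imp_le)
  have nz: "AE x in \<nu>. f \<delta> x = 0 \<longrightarrow> f \<theta> x = 0"
    using f_pos[OF \<delta>] by (intro AE_I2) fastforce
  have b: "1 < exp (1 :: real)" by simp
  have "kl_loss \<nu> f \<theta> \<delta> = (\<integral>x. f \<theta> x * log (exp 1) (f \<theta> x / f \<delta> x) \<partial>\<nu>)"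
    unfolding kl_loss_def model_def
    by (rule KL_density_density[OF b measurable_f pos[OF \<delta>] measurable_f pos[OF \<theta>] nz])
  then show kl: "kl_loss \<nu> f \<theta> \<delta> = intrinsic_loss \<beta> \<theta> \<delta>"
    using g by (simp add: has_bochner_integral_iff)
  have "0 \<le> KL_divergence (exp 1) (density \<nu> (f \<delta>)) (density \<nu> (f \<theta>))"
    using prob_space_model[OF \<theta>] prob_space_model[OF \<delta>] g unfolding model_def
    by (intro KL_density_density_nonneg b measurable_f pos \<theta> \<delta> nz) (auto simp: has_bochner_integral_iff)
  then show "intrinsic_loss \<beta> \<theta> \<delta> \<ge> 0"
    using kl by (simp add: kl_loss_def model_def)
qed

section \<open>Existence of Bayes estimates\<close>

text \<open>
  The posterior risk differs by a constant from the intrinsic loss at any parameter \<open>m\<close> for which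
  \<open>H m\<close> is the posterior mean of \<open>H\<close>. Such an \<open>m\<close> exists in \<open>\<Theta>\<close> by the intermediate value theorem.
\<close>

lemma posterior_risk_has_min:
  fixes p :: "real \<Rightarrow> real"
  assumes p0: "\<And>u. u \<in> \<Theta> \<Longrightarrow> p u \<ge> 0"
    and p: "set_integrable lebesgue \<Theta> p" "(LINT u:\<Theta>|lebesgue. p u) = 1"
    and fin: "\<And>d. d \<in> \<Theta> \<Longrightarrow> set_integrable lebesgue \<Theta> (\<lambda>u. intrinsic_loss \<beta> u d * p u)"
  obtains m where "m \<in> \<Theta>"
    "\<And>d. d \<in> \<Theta> \<Longrightarrow> (LINT u:\<Theta>|lebesgue. intrinsic_loss \<beta> u m * p u)
       \<le> (LINT u:\<Theta>|lebesgue. intrinsic_loss \<beta> u d * p u)"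
proof -
  \<comment> \<open>Between two decisions the loss changes by an affine function of
    \<open>H u\<close>; risk differences therefore depend on the posterior only through its mass and
    its mean of \<open>H\<close>.\<close>
  have diff: "intrinsic_loss \<beta> u d * p u - intrinsic_loss \<beta> u e * p u
      = ln (\<beta> e / \<beta> d) * p u + (d - e) * (H u * p u)"
    if "u \<in> \<Theta>" "d \<in> \<Theta>" "e \<in> \<Theta>" for u d e
  proof -
    have "ln (\<beta> u / \<beta> d) - ln (\<beta> u / \<beta> e) = ln (\<beta> e / \<beta> d)"
      using that[THEN beta_pos] by (simp add: ln_div)
    then have "ln (\<beta> u / \<beta> d) = ln (\<beta> u / \<beta> e) + ln (\<beta> e / \<beta> d)" by simp
    then show ?thesis unfolding intrinsic_loss_def by (simp add: ring_distribs del: times_divide_eq_left times_divide_eq_right)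
  qed
  obtain a where a: "a \<in> \<Theta>" using nonempty_Theta by blast
  obtain c where c: "c > 0" "a + c \<in> \<Theta>"
  proof -
    obtain e where "e > 0" "ball a e \<subseteq> \<Theta>" using open_Theta a open_contains_ball by blast
    then show ?thesis by (intro that[of "e / 2"]) (auto simp: dist_real_def)
  qed
  \<comment> \<open>Finite risk at the two decisions \<open>a\<close> and \<open>a + c\<close> gives
    integrability here: \<open>diff\<close> can be solved for \<open>H u * p u\<close> because its
    slope \<open>c\<close> is non-zero.\<close>
  have Hp: "set_integrable lebesgue \<Theta> (\<lambda>u. H u * p u)"
  proof -
    have "set_integrable lebesgue \<Theta> (\<lambda>u. 1 / c * ((intrinsic_loss \<beta> u (a + c) * p u - intrinsic_loss \<beta> u a * p u)
       - ln (\<beta> a / \<beta> (a + c)) * p u))"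
      by (intro set_integrable_mult_right set_integral_diff(1) fin p a c)
    moreover have "1 / c * ((intrinsic_loss \<beta> u (a + c) * p u - intrinsic_loss \<beta> u a * p u)
       - ln (\<beta> a / \<beta> (a + c)) * p u) = H u * p u" if "u \<in> \<Theta>" for u
      unfolding diff[OF that c(2) a] using c by simp
    ultimately show ?thesis by (simp cong: set_integrable_cong)
  qed
  define \<mu> where "\<mu> = (LINT u:\<Theta>|lebesgue. H u * p u)"
  \<comment> \<open>The mean of \<open>H - \<mu>\<close> under \<open>p\<close> is zero. If
    \<open>H - \<mu>\<close> had a strict constant sign on \<Theta>, \<open>p\<close> would vanish
    almost everywhere, against its mass 1. The factor \<open>s\<close> treats both signs at
    once.\<close>
  have not_one_sided: False
    if s: "\<And>u. u \<in> \<Theta> \<Longrightarrow> s * (H u - \<mu>) > 0" for s :: real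
  proof -
    let ?q = "\<lambda>u. s * (H u * p u - \<mu> * p u)"
    have q: "set_integrable lebesgue \<Theta> ?q"
      by (intro set_integrable_mult_right set_integral_diff(1) Hp p)
    have "(LINT u:\<Theta>|lebesgue. ?q u) = s * (\<mu> - \<mu> * 1)"
      using Hp p by (simp add: set_integral_diff \<mu>_def)
    then have "(\<integral>u. indicator \<Theta> u *\<^sub>R ?q u \<partial>lebesgue) = 0"
      unfolding set_lebesgue_integral_def by (simp only: mult_1_right diff_self mult_zero_right)
    moreover have "0 \<le> indicator \<Theta> u *\<^sub>R ?q u" for u
    proof (cases "u \<in> \<Theta>")
      case True
      then have "0 \<le> s * (H u - \<mu>) * p u"
        using mult_nonneg_nonneg[OF less_imp_le[OF s] p0] by blast
      then show ?thesis using True by (simp add: algebra_simps)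
    qed simp
    ultimately have "AE u in lebesgue. indicator \<Theta> u *\<^sub>R ?q u = 0"
      using q by (subst (asm) integral_nonneg_eq_0_iff_AE) (auto simp: set_integrable_def)
    then have "AE u in lebesgue. indicator \<Theta> u *\<^sub>R p u = 0"
    proof (rule AE_mp, intro AE_I2 impI)
      fix u assume u: "indicator \<Theta> u *\<^sub>R ?q u = 0"
      show "indicator \<Theta> u *\<^sub>R p u = 0"
      proof (cases "u \<in> \<Theta>")
        case True
        then have "s * (H u - \<mu>) * p u = 0" using u by (simp add: algebra_simps)
        then show ?thesis using s[OF True] by auto
      qed simp
    qed
    then have "(LINT u:\<Theta>|lebesgue. p u) = 0"
      unfolding set_lebesgue_integral_def by (rule integral_eq_zero_AE)
    then show False using p by simp
  qed
  obtain u1 where u1: "u1 \<in> \<Theta>" "H u1 \<le> \<mu>" using not_one_sided[of 1] by fastforce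
  obtain u2 where u2: "u2 \<in> \<Theta>" "\<mu> \<le> H u2" using not_one_sided[of "- 1"] by fastforce
  have "connected (H ` \<Theta>)"
    using continuous_on_H interval_Theta is_interval_connected by (intro connected_continuous_image)
  then have "\<mu> \<in> H ` \<Theta>" using connectedD_interval[of "H ` \<Theta>" "H u1" "H u2" \<mu>] u1 u2 by blast
  then obtain m where m: "m \<in> \<Theta>" "H m = \<mu>" by blast
  show thesis
  proof (rule that[OF m(1)])
    fix d assume d: "d \<in> \<Theta>"
    have "(LINT u:\<Theta>|lebesgue. intrinsic_loss \<beta> u d * p u) - (LINT u:\<Theta>|lebesgue. intrinsic_loss \<beta> u m * p u)
      = (LINT u:\<Theta>|lebesgue. intrinsic_loss \<beta> u d * p u - intrinsic_loss \<beta> u m * p u)"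
      by (intro set_integral_diff(2)[symmetric] fin d m)
    also have "\<dots> = (LINT u:\<Theta>|lebesgue. ln (\<beta> m / \<beta> d) * p u + (d - m) * (H u * p u))"
      using diff d m open_Theta by (intro set_lebesgue_integral_cong) auto
    also have "\<dots> = ln (\<beta> m / \<beta> d) * 1 + (d - m) * \<mu>"
      using Hp p by (simp add: set_integral_add \<mu>_def del: times_divide_eq_left times_divide_eq_right)
    also have "\<dots> = intrinsic_loss \<beta> m d" by (simp add: intrinsic_loss_def m)
    finally have "(LINT u:\<Theta>|lebesgue. intrinsic_loss \<beta> u d * p u)
        - (LINT u:\<Theta>|lebesgue. intrinsic_loss \<beta> u m * p u) = intrinsic_loss \<beta> m d" .
    moreover have "intrinsic_loss \<beta> m d \<ge> 0" using m(1) d by (rule kl_loss_eq_intrinsic(2))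
    ultimately show "(LINT u:\<Theta>|lebesgue. intrinsic_loss \<beta> u m * p u)
       \<le> (LINT u:\<Theta>|lebesgue. intrinsic_loss \<beta> u d * p u)" by simp
  qed
qed

lemma fisher_info_nonneg: "fisher_info \<nu> F u \<ge> 0"
  by (simp add: fisher_info_def)

lemma jcp_nonneg: "jcp \<nu> \<beta> t r \<psi> a u \<ge> 0"
  by (cases a) (simp add: jcp_def fisher_info_nonneg)

text \<open>Properness makes the posterior density non-negative with total mass 1, so
  \<open>posterior_risk_has_min\<close> applies to it.\<close>

lemma bayes_estimate_exists:
  assumes x: "x \<in> space \<nu>"
    and adm: "admissible_class (space \<nu>) \<Theta> f (intrinsic_loss \<beta>) (jcp_priors \<nu> \<beta> t r (\<lambda>\<theta>. \<theta>) P)"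
    and a: "a \<in> P"
  obtains m where "m \<in> \<Theta>" "\<And>d. d \<in> \<Theta> \<Longrightarrow>
    posterior_risk \<Theta> f (intrinsic_loss \<beta>) (jcp \<nu> \<beta> t r (\<lambda>\<theta>. \<theta>) a) x m
     \<le> posterior_risk \<Theta> f (intrinsic_loss \<beta>) (jcp \<nu> \<beta> t r (\<lambda>\<theta>. \<theta>) a) x d"
proof -
  let ?\<pi> = "jcp \<nu> \<beta> t r (\<lambda>\<theta>. \<theta>) a"
  let ?p = "posterior_density \<Theta> f ?\<pi> x"
  let ?N = "LINT v:\<Theta>|lebesgue. f v x * ?\<pi> v"
  have "posterior_proper \<Theta> f ?\<pi> x" and
    fin: "\<And>d. d \<in> \<Theta> \<Longrightarrow> set_integrable lebesgue \<Theta> (\<lambda>u. intrinsic_loss \<beta> u d * ?p u)"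
    using adm x a by (auto simp: admissible_class_def jcp_priors_def posterior_risk_finite_def)
  then have N: "set_integrable lebesgue \<Theta> (\<lambda>u. f u x * ?\<pi> u)" "?N > 0"
    by (auto simp: posterior_proper_def)
  have p: "?p = (\<lambda>u. (f u x * ?\<pi> u) / ?N)" by (auto simp: posterior_density_def)
  have "?p u \<ge> 0" if "u \<in> \<Theta>" for u
    using N f_pos[OF that x] jcp_nonneg by (auto simp: p intro!: divide_nonneg_nonneg mult_nonneg_nonneg)
  moreover have "set_integrable lebesgue \<Theta> ?p" unfolding p using N by (intro set_integrable_divide)
  moreover have "(LINT u:\<Theta>|lebesgue. ?p u) = 1" unfolding p using N by simp
  ultimately show ?thesis
    using fin by (rule posterior_risk_has_min) (auto simp: posterior_risk_def intro: that)
qed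

end

section \<open>Change of label\<close>

text \<open>The equality of integrals carries no integrability assumption, so that normalising
  constants can be compared before the posterior is known to be proper.\<close>

lemma set_integral_change_of_variables:
  fixes F g g' :: "real \<Rightarrow> real"
  assumes "S \<in> sets lebesgue"
    and "\<And>x. x \<in> S \<Longrightarrow> (g has_field_derivative g' x) (at x)"
    and "inj_on g S"
  shows "set_integrable lebesgue S (\<lambda>x. F (g x) * \<bar>g' x\<bar>) \<longleftrightarrow> set_integrable lebesgue (g ` S) F" (is ?A)
    and "(LINT x:S|lebesgue. F (g x) * \<bar>g' x\<bar>) = (LINT y:g ` S|lebesgue. F y)" (is ?B)
proof -
  \<comment> \<open>Here \<open>integral\<close> is the gauge integral. As \<open>b\<close> is
    arbitrary, choosing it as the value of one side separates integrability from equality of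
    values.\<close>
  have cv: "set_integrable lebesgue S (\<lambda>x. F (g x) * \<bar>g' x\<bar>)
       \<and> integral S (\<lambda>x. F (g x) * \<bar>g' x\<bar>) = b
     \<longleftrightarrow> set_integrable lebesgue (g ` S) F \<and> integral (g ` S) F = b" for b
    using has_absolute_integral_change_of_variables_1'[of S g g' F b] assms
    by (simp add: has_field_derivative_at_within mult.commute)
  then show ?A by metis
  show ?B
  proof (cases "set_integrable lebesgue (g ` S) F")
    case True
    then show ?thesis
      using cv \<open>?A\<close> by (metis set_lebesgue_integral_eq_integral(2))
  next
    \<comment> \<open>Neither side is integrable, and both Lebesgue integrals take the default value
      0.\<close>
    case False
    then show ?thesis
      using \<open>?A\<close> by (simp add: set_lebesgue_integral_def set_integrable_def not_integrable_integral_eq)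
  qed
qed

lemma arg_min_on_value:
  fixes R :: "real \<Rightarrow> real"
  assumes "m \<in> S" "\<And>d. d \<in> S \<Longrightarrow> R m \<le> R d"
  shows "R (arg_min_on R S) = R m"
  unfolding arg_min_on_def using assms by (intro arg_min_equality)

section \<open>The diffeomorphism and its inverse\<close>

locale relabelled_family = exp_family +
  fixes h :: "real \<Rightarrow> real"
  assumes diffeo: "C1_diffeo_on h \<Theta>"
begin

abbreviation g :: "real \<Rightarrow> real" where "g \<equiv> the_inv_into \<Theta> h"

lemma inj_h: "inj_on h \<Theta>"
  using diffeo by (simp add: C1_diffeo_on_def)

lemma inj_g: "inj_on g (h ` \<Theta>)"
  by (rule inj_on_the_inv_into[OF inj_h])

lemma g_image: "g ` h ` \<Theta> = \<Theta>"
  using the_inv_into_onto[OF inj_h] .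

lemma g_h: "\<theta> \<in> \<Theta> \<Longrightarrow> g (h \<theta>) = \<theta>"
  by (rule the_inv_into_f_f[OF inj_h])

lemma g_mem: "\<eta> \<in> h ` \<Theta> \<Longrightarrow> g \<eta> \<in> \<Theta>"
  by (auto simp: g_h)

lemma g_deriv: "\<eta> \<in> h ` \<Theta> \<Longrightarrow> (g has_real_derivative deriv g \<eta>) (at \<eta>)"
proof -
  assume \<eta>: "\<eta> \<in> h ` \<Theta>"
  obtain D where "(g has_vector_derivative D \<eta>) (at \<eta>)"
    using diffeo \<eta> unfolding C1_diffeo_on_def C1_differentiable_on_def by blast
  then show ?thesis
    by (metis DERIV_imp_deriv has_real_derivative_iff_has_vector_derivative)
qed

text \<open>Supplies the measurability of the new parameter set for the substitution.\<close>

lemma open_image: "open (h ` \<Theta>)"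
proof (rule invariance_of_domain)
  show "continuous_on \<Theta> h"
    using diffeo by (intro C1_differentiable_imp_continuous_on) (simp add: C1_diffeo_on_def)
qed (fact open_Theta inj_h)+

section \<open>Transport of loss, Fisher information and prior\<close>

lemma kl_loss_relabel:
  assumes "u \<in> h ` \<Theta>" "d \<in> h ` \<Theta>"
  shows "kl_loss \<nu> (\<lambda>\<eta>. f (g \<eta>)) u d = intrinsic_loss \<beta> (g u) (g d)"
proof -
  have "kl_loss \<nu> (\<lambda>\<eta>. f (g \<eta>)) u d = kl_loss \<nu> f (g u) (g d)"
    by (simp add: kl_loss_def model_def)
  also have "\<dots> = intrinsic_loss \<beta> (g u) (g d)"
    using assms g_mem by (intro kl_loss_eq_intrinsic) auto
  finally show ?thesis .
qed

text \<open>By the chain rule the score is multiplied by \<open>deriv g u\<close>, which is constant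
  in \<open>x\<close>; its square leaves the expectation.\<close>

lemma fisher_info_relabel:
  assumes u: "u \<in> h ` \<Theta>"
  shows "fisher_info \<nu> (\<lambda>\<eta>. f (g \<eta>)) u = fisher_info \<nu> f (g u) * (deriv g u)\<^sup>2"
proof -
  have gu: "g u \<in> \<Theta>" using u by (rule g_mem)
  have "deriv (\<lambda>v. ln (f (g v) x)) u = deriv (\<lambda>v. ln (f v x)) (g u) * deriv g u"
    if x: "x \<in> space \<nu>" for x
  proof -
    have "((\<lambda>v. \<beta> v * t x * exp (- v * r x)) has_real_derivative
        (deriv \<beta> (g u) * t x * exp (- g u * r x) + \<beta> (g u) * t x * (- r x * exp (- g u * r x)))) (at (g u))"
      using beta_has_derivative[OF gu, THEN DERIV_imp_deriv] beta_has_derivative[OF gu]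
      by (auto intro!: derivative_eq_intros simp: algebra_simps)
    then have "(\<lambda>v. f v x) field_differentiable at (g u)"
      unfolding ef_density_def field_differentiable_def by blast
    then obtain D where "((\<lambda>v. f v x) has_real_derivative D) (at (g u))"
      unfolding field_differentiable_def by blast
    then have D: "((\<lambda>v. ln (f v x)) has_real_derivative 1 / f (g u) x * D) (at (g u))"
      using f_pos[OF gu x] by (auto intro!: derivative_eq_intros)
    have "((\<lambda>v. ln (f (g v) x)) has_real_derivative 1 / f (g u) x * D * deriv g u) (at u)"
      using DERIV_chain2[OF D g_deriv[OF u]] .
    then show ?thesis using D by (simp add: DERIV_imp_deriv)
  qed
  then have "fisher_info \<nu> (\<lambda>\<eta>. f (g \<eta>)) u
      = (\<integral>x. (deriv (\<lambda>v. ln (f v x)) (g u))\<^sup>2 * (deriv g u)\<^sup>2 \<partial>model \<nu> f (g u))"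
    unfolding fisher_info_def
    by (intro Bochner_Integration.integral_cong) (auto simp: model_def power_mult_distrib)
  then show ?thesis by (simp add: fisher_info_def)
qed

text \<open>The conjugate factors depend on the label only through \<open>g u\<close>; the Jacobian
  is the square root of \<open>(deriv g u)\<^sup>2\<close>.\<close>

lemma jcp_relabel:
  "u \<in> h ` \<Theta> \<Longrightarrow> jcp \<nu> \<beta> t r g a u = jcp \<nu> \<beta> t r (\<lambda>\<theta>. \<theta>) a (g u) * \<bar>deriv g u\<bar>"
  unfolding jcp_def by (cases a) (simp only: split_beta fisher_info_relabel real_sqrt_mult real_sqrt_abs fst_conv snd_conv mult.assoc)

text \<open>Substitution in the shape shared by the normalising integral and the risk: the new
  integrand has to be the old one times the Jacobian on the image only.\<close>

lemma set_integral_relabel: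
  fixes F G :: "real \<Rightarrow> real"
  assumes "\<And>u. u \<in> h ` \<Theta> \<Longrightarrow> G u = F (g u) * \<bar>deriv g u\<bar>"
  shows "set_integrable lebesgue (h ` \<Theta>) G \<longleftrightarrow> set_integrable lebesgue \<Theta> F"
    and "(LINT u:h ` \<Theta>|lebesgue. G u) = (LINT \<theta>:\<Theta>|lebesgue. F \<theta>)"
proof -
  have S: "h ` \<Theta> \<in> sets lebesgue" using open_image by simp
  note cv = set_integral_change_of_variables[OF S g_deriv inj_g, unfolded g_image, of F]
  have "set_integrable lebesgue (h ` \<Theta>) G \<longleftrightarrow>
      set_integrable lebesgue (h ` \<Theta>) (\<lambda>u. F (g u) * \<bar>deriv g u\<bar>)"
    using assms by (intro set_integrable_cong) auto
  with cv(1) show "set_integrable lebesgue (h ` \<Theta>) G \<longleftrightarrow> set_integrable lebesgue \<Theta> F" by simp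
  have "(LINT u:h ` \<Theta>|lebesgue. G u) = (LINT u:h ` \<Theta>|lebesgue. F (g u) * \<bar>deriv g u\<bar>)"
    using assms S by (intro set_lebesgue_integral_cong) auto
  with cv(2) show "(LINT u:h ` \<Theta>|lebesgue. G u) = (LINT \<theta>:\<Theta>|lebesgue. F \<theta>)" by simp
qed

section \<open>Transport of posteriors, risks and regrets\<close>

abbreviation prior :: "real \<times> real \<Rightarrow> real \<Rightarrow> real" where
  "prior \<equiv> jcp \<nu> \<beta> t r (\<lambda>\<theta>. \<theta>)"
abbreviation prior' :: "real \<times> real \<Rightarrow> real \<Rightarrow> real" where
  "prior' \<equiv> jcp \<nu> \<beta> t r g"
abbreviation f' :: "real \<Rightarrow> real \<Rightarrow> real" where
  "f' \<equiv> \<lambda>\<eta>. f (g \<eta>)"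

lemma posterior_proper_relabel:
  "posterior_proper (h ` \<Theta>) f' (prior' a) x \<longleftrightarrow> posterior_proper \<Theta> f (prior a) x"
  using set_integral_relabel[of "\<lambda>u. f' u x * prior' a u" "\<lambda>u. f u x * prior a u"]
  by (simp add: posterior_proper_def jcp_relabel)

text \<open>The normalising integrals coincide, so the Jacobian of the prior passes unchanged to the
  posterior.\<close>

lemma posterior_density_relabel:
  "u \<in> h ` \<Theta> \<Longrightarrow> posterior_density (h ` \<Theta>) f' (prior' a) x u
     = posterior_density \<Theta> f (prior a) x (g u) * \<bar>deriv g u\<bar>"
  using set_integral_relabel(2)[of "\<lambda>u. f' u x * prior' a u" "\<lambda>u. f u x * prior a u"]
  by (simp add: posterior_density_def jcp_relabel)

lemma posterior_risk_relabel:
  assumes d: "d \<in> h ` \<Theta>"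
  shows "posterior_risk_finite (h ` \<Theta>) f' (kl_loss \<nu> f') (prior' a) x d
      \<longleftrightarrow> posterior_risk_finite \<Theta> f (intrinsic_loss \<beta>) (prior a) x (g d)"
    and "posterior_risk (h ` \<Theta>) f' (kl_loss \<nu> f') (prior' a) x d
      = posterior_risk \<Theta> f (intrinsic_loss \<beta>) (prior a) x (g d)"
  unfolding posterior_risk_finite_def posterior_risk_def
  by (rule set_integral_relabel; simp add: kl_loss_relabel posterior_density_relabel d)+

lemma admissible_class_relabel:
  "admissible_class (space \<nu>) (h ` \<Theta>) f' (kl_loss \<nu> f') (jcp_priors \<nu> \<beta> t r g P)
     \<longleftrightarrow> admissible_class (space \<nu>) \<Theta> f (intrinsic_loss \<beta>) (jcp_priors \<nu> \<beta> t r (\<lambda>\<theta>. \<theta>) P)"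
  by (simp add: admissible_class_def jcp_priors_def posterior_proper_relabel posterior_risk_relabel g_h)

text \<open>
  The estimates themselves need not correspond, since \<^const>\<open>arg_min_on\<close> is a choice; only the minimal
  risks do, and only because the minimum is attained.
\<close>

lemma posterior_regret_relabel:
  assumes adm: "admissible_class (space \<nu>) \<Theta> f (intrinsic_loss \<beta>) (jcp_priors \<nu> \<beta> t r (\<lambda>\<theta>. \<theta>) P)"
    and x: "x \<in> space \<nu>" and a: "a \<in> P" and d: "d \<in> h ` \<Theta>"
  shows "posterior_regret (h ` \<Theta>) f' (kl_loss \<nu> f') (prior' a) x d
      = posterior_regret \<Theta> f (intrinsic_loss \<beta>) (prior a) x (g d)"
proof -
  let ?R = "posterior_risk \<Theta> f (intrinsic_loss \<beta>) (prior a) x"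
  let ?R' = "posterior_risk (h ` \<Theta>) f' (kl_loss \<nu> f') (prior' a) x"
  obtain m where m: "m \<in> \<Theta>" "\<And>d. d \<in> \<Theta> \<Longrightarrow> ?R m \<le> ?R d"
    using bayes_estimate_exists[OF x adm a] by blast
  have "?R (arg_min_on ?R \<Theta>) = ?R m" using m by (rule arg_min_on_value)
  \<comment> \<open>The relabelled risk is \<open>?R\<close> composed with \<open>g\<close>, and
    \<open>g (h m) = m\<close>, so \<open>h m\<close> minimises it.\<close>
  moreover have "?R' (arg_min_on ?R' (h ` \<Theta>)) = ?R' (h m)"
    using m by (intro arg_min_on_value) (auto simp: posterior_risk_relabel g_h)
  ultimately show ?thesis
    using m(1) d by (simp add: posterior_regret_def bayes_estimate_def posterior_risk_relabel g_h)
qed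

text \<open>Worst-case regrets agree pointwise along \<open>g\<close>, and \<open>g\<close> maps the
  new parameter set onto \<Theta>, so their infima agree too.\<close>

lemma prgm_estimator_relabel:
  assumes adm: "admissible_class (space \<nu>) \<Theta> f (intrinsic_loss \<beta>) (jcp_priors \<nu> \<beta> t r (\<lambda>\<theta>. \<theta>) P)"
    and d: "\<And>x. x \<in> space \<nu> \<Longrightarrow> d x \<in> h ` \<Theta>"
  shows "prgm_estimator (space \<nu>) (h ` \<Theta>) f' (kl_loss \<nu> f') (jcp_priors \<nu> \<beta> t r g P) d
     \<longleftrightarrow> prgm_estimator (space \<nu>) \<Theta> f (intrinsic_loss \<beta>) (jcp_priors \<nu> \<beta> t r (\<lambda>\<theta>. \<theta>) P) (\<lambda>x. g (d x))"
proof -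
  let ?S = "\<lambda>x \<theta>. SUP \<pi>\<in>jcp_priors \<nu> \<beta> t r (\<lambda>\<theta>. \<theta>) P.
    ereal (posterior_regret \<Theta> f (intrinsic_loss \<beta>) \<pi> x \<theta>)"
  let ?S' = "\<lambda>x \<eta>. SUP \<pi>\<in>jcp_priors \<nu> \<beta> t r g P.
    ereal (posterior_regret (h ` \<Theta>) f' (kl_loss \<nu> f') \<pi> x \<eta>)"
  \<comment> \<open>The two classes contain different functions; \<open>image_image\<close> makes
    both suprema range over the common index set \<open>P\<close>.\<close>
  have S: "?S' x \<eta> = ?S x (g \<eta>)" if "x \<in> space \<nu>" "\<eta> \<in> h ` \<Theta>" for x \<eta>
    unfolding jcp_priors_def image_image
    by (intro SUP_cong refl) (simp add: posterior_regret_relabel[OF adm that(1) _ that(2)])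
  have I: "(INF \<eta>\<in>h ` \<Theta>. ?S' x \<eta>) = (INF \<theta>\<in>\<Theta>. ?S x \<theta>)" if x: "x \<in> space \<nu>" for x
  proof -
    have "(INF \<eta>\<in>h ` \<Theta>. ?S' x \<eta>) = (INF \<eta>\<in>h ` \<Theta>. ?S x (g \<eta>))"
      using S[OF x] by (intro INF_cong) auto
    also have "\<dots> = (INF \<theta>\<in>g ` h ` \<Theta>. ?S x \<theta>)" by (simp add: image_image)
    finally show ?thesis by (simp only: g_image)
  qed
  show ?thesis
    unfolding prgm_estimator_def
  proof (intro ball_cong refl)
    fix x assume x: "x \<in> space \<nu>"
    show "(d x \<in> h ` \<Theta> \<and> ?S' x (d x) = (INF \<eta>\<in>h ` \<Theta>. ?S' x \<eta>))
       \<longleftrightarrow> (g (d x) \<in> \<Theta> \<and> ?S x (g (d x)) = (INF \<theta>\<in>\<Theta>. ?S x \<theta>))"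
      using d[OF x] S[OF x d[OF x]] I[OF x] g_mem by simp
  qed
qed

end

section \<open>Equivariance of the estimator, with transfer of uniqueness\<close>

theorem theorem2:
  fixes \<nu> :: "real measure" and \<Theta> :: "real set" and \<beta> t r :: "real \<Rightarrow> real"
    and P :: "(real \<times> real) set" and \<delta> h :: "real \<Rightarrow> real"
  assumes family: "exp_family \<nu> \<Theta> \<beta> t r"
    and jcp_class: "admissible_class (space \<nu>) \<Theta> (ef_density \<beta> t r) (intrinsic_loss \<beta>)
      (jcp_priors \<nu> \<beta> t r (\<lambda>\<theta>. \<theta>) P)"
    and prgm: "prgm_estimator (space \<nu>) \<Theta> (ef_density \<beta> t r) (intrinsic_loss \<beta>)
      (jcp_priors \<nu> \<beta> t r (\<lambda>\<theta>. \<theta>) P) \<delta>"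
    and diffeo: "C1_diffeo_on h \<Theta>"
  shows
    "let g = the_inv_into \<Theta> h;
         f' = (\<lambda>\<eta>. ef_density \<beta> t r (g \<eta>));
         \<Gamma>' = jcp_priors \<nu> \<beta> t r g P
     in admissible_class (space \<nu>) (h ` \<Theta>) f' (kl_loss \<nu> f') \<Gamma>'
        \<and> prgm_estimator (space \<nu>) (h ` \<Theta>) f' (kl_loss \<nu> f') \<Gamma>' (\<lambda>x. h (\<delta> x))
        \<and> ((\<forall>\<delta>'. prgm_estimator (space \<nu>) \<Theta> (ef_density \<beta> t r) (intrinsic_loss \<beta>)
                    (jcp_priors \<nu> \<beta> t r (\<lambda>\<theta>. \<theta>) P) \<delta>' \<longrightarrow> (\<forall>x\<in>space \<nu>. \<delta>' x = \<delta> x))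
            \<longrightarrow> (\<forall>d. prgm_estimator (space \<nu>) (h ` \<Theta>) f' (kl_loss \<nu> f') \<Gamma>' d
                    \<longrightarrow> (\<forall>x\<in>space \<nu>. d x = h (\<delta> x))))"
proof -
  interpret exp_family \<nu> \<Theta> \<beta> t r by (rule family)
  interpret relabelled_family \<nu> \<Theta> \<beta> t r h by unfold_locales (rule diffeo)
  let ?\<Gamma> = "jcp_priors \<nu> \<beta> t r (\<lambda>\<theta>. \<theta>) P" and ?\<Gamma>' = "jcp_priors \<nu> \<beta> t r g P"
  let ?prgm = "prgm_estimator (space \<nu>) \<Theta> f (intrinsic_loss \<beta>) ?\<Gamma>"
  let ?prgm' = "prgm_estimator (space \<nu>) (h ` \<Theta>) f' (kl_loss \<nu> f') ?\<Gamma>'"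
  have \<delta>: "\<delta> x \<in> \<Theta>" if "x \<in> space \<nu>" for x
    using prgm that by (auto simp: prgm_estimator_def)
  have "?prgm (\<lambda>x. g (h (\<delta> x)))"
    using prgm \<delta> by (simp add: prgm_estimator_def g_h cong: ball_cong)
  then have opt: "?prgm' (\<lambda>x. h (\<delta> x))"
    using \<delta> by (subst prgm_estimator_relabel[OF jcp_class]) auto
  \<comment> \<open>A competitor \<open>d\<close> for the new label pulls back along
    \<open>g\<close> to a competitor for \<theta>, which must equal \<delta> on the sample space;
    applying \<open>h\<close> recovers \<open>d\<close>.\<close>
  have unique: "d x = h (\<delta> x)"
    if only: "\<forall>\<delta>'. ?prgm \<delta>' \<longrightarrow> (\<forall>x\<in>space \<nu>. \<delta>' x = \<delta> x)" and d: "?prgm' d" and x: "x \<in> space \<nu>"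
    for d x
  proof -
    have dh: "d x \<in> h ` \<Theta>" if "x \<in> space \<nu>" for x
      using d that by (auto simp: prgm_estimator_def)
    have "?prgm (\<lambda>x. g (d x))" using d by (subst (asm) prgm_estimator_relabel[OF jcp_class dh])
    then have "g (d x) = \<delta> x" using only x by blast
    then show ?thesis using f_the_inv_into_f[OF inj_h dh[OF x]] by simp
  qed
  show ?thesis
    unfolding Let_def using opt unique jcp_class by (auto simp: admissible_class_relabel)
qed

end
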